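(* Let $\{(\tilde z_k,z_k,r_k,\varepsilon_k,\lambda_k,\eta_k)\}$ be generated by the NE-HPE framework (with $\sigma\in[0,1]$). For $k\ge1$ let $\Lambda_k=\sum_{i=1}^k\lambda_i$ and $$\tilde z_k^a=\frac1{\Lambda_k}\sum_{i=1}^k\lambda_i\tilde z_i,\qquad r_k^a=\frac1{\Lambda_k}\sum_{i=1}^k\lambda_ir_i,\qquad \varepsilon_k^a=\frac1{\Lambda_k}\sum_{i=1}^k\lambda_i\left(\varepsilon_i+\langle r_i,\tilde z_i-\tilde z_k^a\rangle\right).$$ Then, for every $k\ge1$, $r_k^a\in T^{[\varepsilon_k^a]}(\tilde z_k^a)$ and $$\|r_k^a\|^*\le\frac{2\sqrt2M((dw)_0+\eta_0)^{1/2}}{\sqrt m\,\Lambda_k},\qquad \varepsilon_k^a\le\left(\frac{3M}{m}\right)\left[\frac{3((dw)_0+\eta_0)+\sigma\rho_k}{\Lambda_k}\right],$$ where $\rho_k:=\max_{i=1,\dots,k}(dw)_{z_{i-1}}(\tilde z_i)$. Moreover, the sequence $\{\rho_k\}$ is bounded under either one of the following situations: (a) $\sigma<1$, in which case $\rho_k\le\dfrac{(dw)_0+\eta_0}{1-\sigma}$; (b) $\mathrm{Dom}\,T$ is bounded, in which case $\rho_k\le\dfrac{2M}{m}\left[(dw)_0+\eta_0+D\right]$, where $D:=\sup\{\min\{(dw)_y(y'),(dw)_{y'}(y)\}:y,y'\in\mathrm{Dom}\,T\}$ is the diameter of $\mathrm{Dom}\,T$ with respect to $dw$.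
   Context: $\mathcal Z$ is a finite-dimensional real inner product space. A proper lower semicontinuous convex $w:\mathcal Z\to(-\infty,\infty]$ is a distance generating function if $\mathrm{int}(\mathrm{dom}\,w)=\mathrm{Dom}\,\partial w\ne\emptyset$ and $w$ is continuously differentiable on this interior; its Bregman distance is $(dw)_z(z')=w(z')-w(z)-\langle\nabla w(z),z'-z\rangle$ for $z'\in\mathcal Z$, $z\in\mathrm{int}(\mathrm{dom}\,w)$, and $\nabla(dw)_z(z')=\nabla w(z')-\nabla w(z)$ for $z,z'\in\mathrm{int}(\mathrm{dom}\,w)$. For a seminorm $\|\cdot\|$ on $\mathcal Z$, the dual (extended) seminorm is $\|u\|^*=\sup\{\langle u,v\rangle:\|v\|\le1\}$. For a convex set $Z\subset\mathrm{int}(\mathrm{dom}\,w)$ and positive constants $m,M$, $w$ is $(m,M)$-regular with respect to $(Z,\|\cdot\|)$ if for all $z,z'\in Z$: $(dw)_z(z')\ge\frac m2\|z-z'\|^2$ and $\|\nabla w(z)-\nabla w(z')\|^*\le M\|z-z'\|$. Standing assumptions: $Z\subset\mathrm{int}(\mathrm{dom}\,w)$ is a closed convex set, $\|\cdot\|$ is a seminorm on $\mathcal Z$, $w$ is an $(m,M)$-regular distance generating function with respect to $(Z,\|\cdot\|)$; $T:\mathcal Z\rightrightarrows\mathcal Z$ is maximal monotone with $\mathrm{Dom}\,T=\{z:T(z)\ne\emptyset\}\subset Z$ and $T^{-1}(0)=\{z:0\in T(z)\}\ne\emptyset$. For $\varepsilon\ge0$, $T^{[\varepsilon]}(v)=\{v':\langle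 v'-v_2,v-v_1\rangle\ge-\varepsilon\ \ \forall v_1,\ \forall v_2\in T(v_1)\}$. NE-HPE framework: given $z_0\in Z$, $\eta_0\ge0$, $\sigma\in[0,1]$, at every iteration $k=1,2,\dots$ one chooses $\lambda_k>0$ and $(\tilde z_k,z_k,\varepsilon_k,\eta_k)\in Z\times Z\times\mathbb R_+\times\mathbb R_+$ such that $$r_k:=\frac1{\lambda_k}\nabla(dw)_{z_k}(z_{k-1})\in T^{[\varepsilon_k]}(\tilde z_k),\qquad (dw)_{z_k}(\tilde z_k)+\lambda_k\varepsilon_k+\eta_k\le\sigma(dw)_{z_{k-1}}(\tilde z_k)+\eta_{k-1}.$$ Also $(dw)_0:=\inf\{(dw)_{z_0}(z^* ):z^*\in T^{-1}(0)\}$.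
   Formalization: The bound on ε_k^a is claimed only if m ≤ M or the seminorm of some difference of two points of Z is nonzero (which forces m ≤ M); if the seminorm vanishes on Z−Z and m > M, the printed bound can fail, e.g. w=0, zero seminorm, T≡{0}, m=10, M=1, η_0=ε_1=λ_1=1. *)

theory Defs
  imports "HOL-Analysis.Analysis"
begin

section \<open>Extended-real-valued convex functions\<close>

definition edom :: "('a \<Rightarrow> ereal) \<Rightarrow> 'a set" where
  "edom f = {z. f z < \<infinity>}"

definition proper_fun :: "('a \<Rightarrow> ereal) \<Rightarrow> bool" where
  "proper_fun f \<longleftrightarrow> (\<forall>z. f z \<noteq> -\<infinity>) \<and> edom f \<noteq> {}"

definition lower_semicontinuous :: "('a::topological_space \<Rightarrow> ereal) \<Rightarrow> bool" where
  "lower_semicontinuous f \<longleftrightarrow> (\<forall>z. f z \<le> Liminf (at z) f)"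

definition convex_fun :: "('a::real_vector \<Rightarrow> ereal) \<Rightarrow> bool" where
  "convex_fun f \<longleftrightarrow>
     (\<forall>x y. \<forall>t::real. 0 < t \<and> t < 1 \<longrightarrow>
        f ((1 - t) *\<^sub>R x + t *\<^sub>R y) \<le> ereal (1 - t) * f x + ereal t * f y)"

definition subdiff :: "('a::real_inner \<Rightarrow> ereal) \<Rightarrow> 'a \<Rightarrow> 'a set" where
  "subdiff f z = {g. \<forall>z'. f z + ereal (g \<bullet> (z' - z)) \<le> f z'}"

text \<open>
  Gradient of an extended-real-valued function. It is meaningful only at interior points of
  \<^const>\<open>edom\<close> where the function is differentiable.
\<close>
definition grad :: "('a::real_inner \<Rightarrow> ereal) \<Rightarrow> 'a \<Rightarrow> 'a" where
  "grad f z = (THE g. GDERIV (\<lambda>x. real_of_ereal (f x)) z :> g)"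

section \<open>Distance generating functions and Bregman distances\<close>

definition distance_generating :: "('a::euclidean_space \<Rightarrow> ereal) \<Rightarrow> bool" where
  "distance_generating w \<longleftrightarrow>
     proper_fun w \<and> lower_semicontinuous w \<and> convex_fun w \<and>
     interior (edom w) = {z. subdiff w z \<noteq> {}} \<and> interior (edom w) \<noteq> {} \<and>
     (\<forall>z\<in>interior (edom w). \<exists>g. GDERIV (\<lambda>x. real_of_ereal (w x)) z :> g) \<and>
     continuous_on (interior (edom w)) (grad w)"

text \<open>
  \<open>bregman w z z'\<close> is $(dw)_z(z')$: the base point \<open>z\<close> comes first.
\<close>
definition bregman :: "('a::real_inner \<Rightarrow> ereal) \<Rightarrow> 'a \<Rightarrow> 'a \<Rightarrow> ereal" where
  "bregman w z z' = w z' - w z - ereal (grad w z \<bullet> (z' - z))"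

definition seminorm :: "('a::real_vector \<Rightarrow> real) \<Rightarrow> bool" where
  "seminorm p \<longleftrightarrow>
     (\<forall>x. 0 \<le> p x) \<and> (\<forall>c x. p (c *\<^sub>R x) = \<bar>c\<bar> * p x) \<and> (\<forall>x y. p (x + y) \<le> p x + p y)"

definition dual_seminorm :: "('a::real_inner \<Rightarrow> real) \<Rightarrow> 'a \<Rightarrow> ereal" where
  "dual_seminorm p u = (SUP v\<in>{v. p v \<le> 1}. ereal (u \<bullet> v))"

definition regular_wrt ::
    "real \<Rightarrow> real \<Rightarrow> ('a::euclidean_space \<Rightarrow> ereal) \<Rightarrow> 'a set \<Rightarrow> ('a \<Rightarrow> real) \<Rightarrow> bool" where
  "regular_wrt m M w Z p \<longleftrightarrow>
     0 < m \<and> 0 < M \<and> convex Z \<and> Z \<subseteq> interior (edom w) \<and>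
     (\<forall>z\<in>Z. \<forall>z'\<in>Z.
        ereal (m / 2 * (p (z - z'))\<^sup>2) \<le> bregman w z z' \<and>
        dual_seminorm p (grad w z - grad w z') \<le> ereal (M * p (z - z')))"

section \<open>Set-valued operators\<close>

definition Dom :: "('a \<Rightarrow> 'b set) \<Rightarrow> 'a set" where
  "Dom T = {z. T z \<noteq> {}}"

definition zeros :: "('a \<Rightarrow> 'b::zero set) \<Rightarrow> 'a set" where
  "zeros T = {z. 0 \<in> T z}"

definition monotone_op :: "('a::real_inner \<Rightarrow> 'a set) \<Rightarrow> bool" where
  "monotone_op T \<longleftrightarrow> (\<forall>x y. \<forall>u\<in>T x. \<forall>v\<in>T y. 0 \<le> (u - v) \<bullet> (x - y))"

definition maximal_monotone :: "('a::real_inner \<Rightarrow> 'a set) \<Rightarrow> bool" where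
  "maximal_monotone T \<longleftrightarrow>
     monotone_op T \<and> (\<forall>S. monotone_op S \<and> (\<forall>x. T x \<subseteq> S x) \<longrightarrow> S = T)"

definition enlargement :: "('a::real_inner \<Rightarrow> 'a set) \<Rightarrow> real \<Rightarrow> 'a \<Rightarrow> 'a set" where
  "enlargement T \<epsilon> v = {v'. \<forall>v1. \<forall>v2\<in>T v1. - \<epsilon> \<le> (v' - v2) \<bullet> (v - v1)}"

section \<open>The NE-HPE framework\<close>

text \<open>
  The sequences \<open>zt\<close>, \<open>r\<close>, \<open>eps\<close>, \<open>lam\<close> are used from index 1 on; their values at 0 are irrelevant.
  In the equation for \<open>r\<close> the gradient is taken in the second argument of \<^const>\<open>bregman\<close>.
\<close>
definition ne_hpe ::
    "('a::euclidean_space \<Rightarrow> ereal) \<Rightarrow> 'a set \<Rightarrow> ('a \<Rightarrow> 'a set) \<Rightarrow> real \<Rightarrow>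
     (nat \<Rightarrow> 'a) \<Rightarrow> (nat \<Rightarrow> 'a) \<Rightarrow> (nat \<Rightarrow> 'a) \<Rightarrow>
     (nat \<Rightarrow> real) \<Rightarrow> (nat \<Rightarrow> real) \<Rightarrow> (nat \<Rightarrow> real) \<Rightarrow> bool" where
  "ne_hpe w Z T \<sigma> zt z r eps lam eta \<longleftrightarrow>
     z 0 \<in> Z \<and> 0 \<le> eta 0 \<and> 0 \<le> \<sigma> \<and> \<sigma> \<le> 1 \<and>
     (\<forall>k\<ge>1. 0 < lam k \<and> zt k \<in> Z \<and> z k \<in> Z \<and> 0 \<le> eps k \<and> 0 \<le> eta k \<and>
        r k = (1 / lam k) *\<^sub>R grad (bregman w (z k)) (z (k - 1)) \<and>
        r k \<in> enlargement T (eps k) (zt k) \<and>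
        bregman w (z k) (zt k) + ereal (lam k * eps k + eta k)
          \<le> ereal \<sigma> * bregman w (z (k - 1)) (zt k) + ereal (eta (k - 1)))"

definition dw0 :: "('a::real_inner \<Rightarrow> ereal) \<Rightarrow> ('a \<Rightarrow> 'a set) \<Rightarrow> 'a \<Rightarrow> ereal" where
  "dw0 w T z0 = (INF zs\<in>zeros T. bregman w z0 zs)"

definition Lam :: "(nat \<Rightarrow> real) \<Rightarrow> nat \<Rightarrow> real" where
  "Lam lam k = (\<Sum>i=1..k. lam i)"

definition ergodic :: "(nat \<Rightarrow> real) \<Rightarrow> (nat \<Rightarrow> 'a::real_vector) \<Rightarrow> nat \<Rightarrow> 'a" where
  "ergodic lam x k = (1 / Lam lam k) *\<^sub>R (\<Sum>i=1..k. lam i *\<^sub>R x i)"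

definition ergodic_eps ::
    "(nat \<Rightarrow> real) \<Rightarrow> (nat \<Rightarrow> real) \<Rightarrow> (nat \<Rightarrow> 'a::real_inner) \<Rightarrow> (nat \<Rightarrow> 'a) \<Rightarrow> nat \<Rightarrow> real" where
  "ergodic_eps lam eps r zt k =
     (1 / Lam lam k) * (\<Sum>i=1..k. lam i * (eps i + r i \<bullet> (zt i - ergodic lam zt k)))"

definition rho :: "('a::real_inner \<Rightarrow> ereal) \<Rightarrow> (nat \<Rightarrow> 'a) \<Rightarrow> (nat \<Rightarrow> 'a) \<Rightarrow> nat \<Rightarrow> ereal" where
  "rho w z zt k = Max ((\<lambda>i. bregman w (z (i - 1)) (zt i)) ` {1..k})"

definition breg_diameter :: "('a::real_inner \<Rightarrow> ereal) \<Rightarrow> 'a set \<Rightarrow> ereal" where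
  "breg_diameter w S = (SUP (y, y')\<in>S \<times> S. min (bregman w y y') (bregman w y' y))"

end

theory Submission
  imports Defs
begin

text \<open>
  The three-point identity for \<open>dw\<close> turns the relative error criterion into a descent inequality
  for \<open>(dw)\<^bsub>z_k\<^esub>(x) + \<eta>_k\<close>. At a zero \<open>x\<close> of \<open>T\<close> it keeps this quantity below its initial
  value and bounds \<open>\<rho>_k\<close> if \<open>\<sigma> < 1\<close>; summed at \<open>x\<close> equal to the ergodic mean it bounds \<open>\<epsilon>\<^sup>a_k\<close> by
  \<open>(dw)\<^bsub>z_0\<^esub>\<close> at that mean, hence by convexity by an average of \<open>(dw)\<^bsub>z_0\<^esub>\<close> over the points \<open>zt i\<close>.
  The weighted residuals telescope to \<open>\<nabla>w(z_0) - \<nabla>w(z_k)\<close>, and regularity compares \<open>dw\<close> with the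
  squared seminorm from both sides. If \<open>Dom T\<close> is bounded, every \<open>zt k\<close> lies in its closure, because
  \<open>T(y)\<close> contains \<open>v + c(x - y)\<close> for some \<open>y\<close> within distance \<open>\<surd>(\<epsilon>/c)\<close> of \<open>x\<close> whenever
  \<open>v \<in> T\<^sup>[\<^sup>\<epsilon>\<^sup>](x)\<close> and \<open>c > 0\<close>.
\<close>

section \<open>Seminorms and regular distance generating functions\<close>

lemma dual_seminorm_le_iff:
  "dual_seminorm p u \<le> ereal B \<longleftrightarrow> (\<forall>v. p v \<le> 1 \<longrightarrow> u \<bullet> v \<le> B)"
  by (auto simp: dual_seminorm_def SUP_le_iff)

lemma seminorm_minus_commute:
  assumes "seminorm p"
  shows "p (x - y) = p (y - x)"
proof -
  have "p ((- 1) *\<^sub>R (y - x)) = \<bar>- 1\<bar> * p (y - x)"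
    using assms unfolding seminorm_def by blast
  then show ?thesis
    by simp
qed

lemma seminorm_diff_triangle:
  assumes "seminorm p"
  shows "p (x - z) \<le> p (x - y) + p (y - z)"
proof -
  have "p ((x - y) + (y - z)) \<le> p (x - y) + p (y - z)"
    using assms unfolding seminorm_def by blast
  then show ?thesis
    by simp
qed

text \<open>Scaling \<open>v\<close> to the unit ball of \<open>p\<close> gives the bound if
  \<open>p v > 0\<close>. If \<open>p v = 0\<close>, every multiple of \<open>v\<close> lies in the
  ball, which forces \<open>u \<bullet> v \<le> 0\<close>.\<close>

lemma inner_le_dual_seminorm:
  assumes p: "seminorm p" and u: "dual_seminorm p u \<le> ereal B"
  shows "u \<bullet> v \<le> B * p v"
proof (cases "p v = 0")
  case True
  have "p (c *\<^sub>R v) = 0" for c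
    using p True by (simp add: seminorm_def)
  then have le: "c * (u \<bullet> v) \<le> B" for c
    using u[unfolded dual_seminorm_le_iff, rule_format, of "c *\<^sub>R v"] by simp
  have "u \<bullet> v \<le> 0"
  proof (rule ccontr)
    assume "\<not> u \<bullet> v \<le> 0"
    then show False
      using le[of "(B + 1) / (u \<bullet> v)"] by simp
  qed
  then show ?thesis
    using True by simp
next
  case False
  then have pos: "0 < p v"
    using p by (simp add: seminorm_def less_le)
  then have "p ((1 / p v) *\<^sub>R v) \<le> 1"
    using p by (simp add: seminorm_def)
  then have "u \<bullet> ((1 / p v) *\<^sub>R v) \<le> B"
    using u[unfolded dual_seminorm_le_iff] by blast
  then show ?thesis
    using pos by (simp add: field_simps)
qed

text \<open>Expanding \<open>x\<close> in the basis gives the constant. The lemma later carries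
  \<open>p\<close>-estimates over to closures and makes the Bregman diameter of a bounded domain
  finite.\<close>

lemma seminorm_le_norm:
  fixes p :: "'a::euclidean_space \<Rightarrow> real"
  assumes "seminorm p"
  obtains C where "0 \<le> C" "\<And>x. p x \<le> C * norm x"
proof
  let ?C = "\<Sum>b\<in>Basis. p b"
  have p0: "p 0 = 0"
    using assms unfolding seminorm_def by (metis abs_zero mult_zero_left scale_zero_left)
  have nonneg: "0 \<le> p x" for x
    using assms by (simp add: seminorm_def)
  show "0 \<le> ?C"
    by (simp add: nonneg sum_nonneg)
  fix x :: 'a
  have sum_le: "p (\<Sum>b\<in>B. (x \<bullet> b) *\<^sub>R b) \<le> (\<Sum>b\<in>B. p ((x \<bullet> b) *\<^sub>R b))"
    if "finite B" for B
    using that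
  proof (induction B)
    case empty
    then show ?case by (simp add: p0)
  next
    case (insert b B)
    have "p ((x \<bullet> b) *\<^sub>R b + (\<Sum>b\<in>B. (x \<bullet> b) *\<^sub>R b))
        \<le> p ((x \<bullet> b) *\<^sub>R b) + p (\<Sum>b\<in>B. (x \<bullet> b) *\<^sub>R b)"
      using assms unfolding seminorm_def by blast
    then show ?case
      using insert by simp
  qed
  have "p x \<le> (\<Sum>b\<in>Basis. p ((x \<bullet> b) *\<^sub>R b))"
    using sum_le[of Basis] by (simp add: euclidean_representation)
  also have "\<dots> = (\<Sum>b\<in>Basis. \<bar>x \<bullet> b\<bar> * p b)"
    using assms by (simp add: seminorm_def)
  also have "\<dots> \<le> (\<Sum>b\<in>Basis. norm x * p b)"
    by (intro sum_mono mult_right_mono) (auto simp: Basis_le_norm nonneg)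
  finally show "p x \<le> ?C * norm x"
    by (simp add: sum_distrib_left mult.commute)
qed

lemma grad_eqI:
  assumes "GDERIV (\<lambda>x. real_of_ereal (f x)) z :> d"
  shows "grad f z = d"
  unfolding grad_def
proof (rule the_equality[where a = d])
  fix d' assume "GDERIV (\<lambda>x. real_of_ereal (f x)) z :> d'"
  then have "(\<lambda>h. h \<bullet> d') = (\<lambda>h. h \<bullet> d)"
    using assms unfolding gderiv_def by (rule has_derivative_unique)
  then have "(d' - d) \<bullet> d' = (d' - d) \<bullet> d"
    by (rule fun_cong)
  then have "(d' - d) \<bullet> (d' - d) = 0"
    by (simp add: inner_diff_right)
  then show "d' = d"
    by simp
qed (rule assms)

lemma distance_generating_gderiv:
  assumes "distance_generating w" "x \<in> interior (edom w)"
  shows "GDERIV (\<lambda>x. real_of_ereal (w x)) x :> grad w x"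
proof -
  obtain d where d: "GDERIV (\<lambda>x. real_of_ereal (w x)) x :> d"
    using assms unfolding distance_generating_def by blast
  then show ?thesis
    using grad_eqI[OF d] by simp
qed

lemma distance_generating_finite:
  assumes "distance_generating w" "x \<in> interior (edom w)"
  shows "w x = ereal (real_of_ereal (w x))"
proof -
  have "x \<in> edom w"
    using assms(2) interior_subset by blast
  then show ?thesis
    using assms(1) by (auto simp: distance_generating_def proper_fun_def edom_def ereal_real)
qed

lemma grad_bregman:
  assumes w: "distance_generating w" and "a \<in> interior (edom w)" "b \<in> interior (edom w)"
  shows "grad (bregman w a) b = grad w b - grad w a"
proof (rule grad_eqI)
  let ?f = "\<lambda>x. real_of_ereal (w x)"
  have "((\<lambda>x. ?f x - ?f a - grad w a \<bullet> (x - a)) has_derivative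
          (\<lambda>h. h \<bullet> (grad w b - grad w a))) (at b)"
    using distance_generating_gderiv[OF w assms(3)] unfolding gderiv_def
    by (auto intro!: derivative_eq_intros simp: inner_diff_right inner_commute)
  then have "((\<lambda>x. real_of_ereal (bregman w a x)) has_derivative
          (\<lambda>h. h \<bullet> (grad w b - grad w a))) (at b)"
  \<comment> \<open>The real and the extended expressions agree only where \<open>w\<close> is
    finite; the interior is an open neighbourhood of \<open>b\<close> on which it is.\<close>
  proof (rule has_derivative_transform_within_open[of _ _ _ UNIV "interior (edom w)"])
    fix x assume "x \<in> interior (edom w)"
    then obtain s t where "w x = ereal s" "w a = ereal t"
      using distance_generating_finite[OF w] assms(2) by meson
    then show "?f x - ?f a - grad w a \<bullet> (x - a) = real_of_ereal (bregman w a x)"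
      by (simp add: bregman_def)
  qed (use assms in auto)
  then show "GDERIV (\<lambda>x. real_of_ereal (bregman w a x)) b :> grad w b - grad w a"
    by (simp add: gderiv_def)
qed

section \<open>Comparison of the Bregman distance with the squared seminorm\<close>

locale regular_dgf =
  fixes w :: "'a::euclidean_space \<Rightarrow> ereal" and Z :: "'a set" and p :: "'a \<Rightarrow> real" and m M :: real
  assumes semi: "seminorm p" and dgf: "distance_generating w" and reg: "regular_wrt m M w Z p"
begin

text \<open>A real-valued stand-in for \<open>bregman w\<close>, faithful on \<open>Z\<close> by
  \<open>bregman_eq_D\<close>, so that the estimates can be done in real arithmetic.\<close>

definition D :: "'a \<Rightarrow> 'a \<Rightarrow> real" where
  "D a b = real_of_ereal (w b) - real_of_ereal (w a) - grad w a \<bullet> (b - a)"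

lemma m_pos: "0 < m" and M_pos: "0 < M" and convex_Z: "convex Z"
  and Z_interior: "Z \<subseteq> interior (edom w)"
  using reg by (auto simp: regular_wrt_def)

lemma p_nonneg: "0 \<le> p x"
  using semi by (simp add: seminorm_def)

lemma bregman_eq_D:
  assumes "a \<in> Z" "b \<in> Z"
  shows "bregman w a b = ereal (D a b)"
proof -
  obtain s t where "w a = ereal s" "w b = ereal t"
    using distance_generating_finite[OF dgf] Z_interior assms by (meson subsetD)
  then show ?thesis
    by (simp add: bregman_def D_def)
qed

lemma D_ge:
  assumes "a \<in> Z" "b \<in> Z"
  shows "m / 2 * (p (a - b))\<^sup>2 \<le> D a b"
  using reg assms bregman_eq_D by (fastforce simp: regular_wrt_def)

lemma D_nonneg:
  assumes "a \<in> Z" "b \<in> Z"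
  shows "0 \<le> D a b"
  using D_ge[OF assms] m_pos by (smt (verit) mult_nonneg_nonneg half_gt_zero zero_le_power2)

lemma grad_lipschitz:
  assumes "a \<in> Z" "b \<in> Z"
  shows "dual_seminorm p (grad w a - grad w b) \<le> ereal (M * p (a - b))"
  using reg assms by (simp add: regular_wrt_def)

text \<open>The Lipschitz bound on the gradient is integrated along the segment from
  \<open>a\<close> to \<open>b\<close>, which stays in \<open>Z\<close> by convexity.\<close>

lemma D_le:
  assumes a: "a \<in> Z" and b: "b \<in> Z"
  shows "D a b \<le> M / 2 * (p (a - b))\<^sup>2"
proof -
  let ?f = "\<lambda>x. real_of_ereal (w x)"
  define c where "c t = a + t *\<^sub>R (b - a)" for t :: real
  \<comment> \<open>\<open>\<phi>\<close> is chosen so that \<open>\<phi> 1 \<le> \<phi> 0\<close>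
    is the claim, while the Lipschitz bound makes its derivative nonpositive.\<close>
  define \<phi> where "\<phi> t = ?f (c t) - t * (grad w a \<bullet> (b - a)) - M / 2 * (p (b - a))\<^sup>2 * t\<^sup>2" for t
  have cZ: "c t \<in> Z" if "0 \<le> t" "t \<le> 1" for t
  proof -
    have "c t = (1 - t) *\<^sub>R a + t *\<^sub>R b"
      by (simp add: c_def algebra_simps)
    then show ?thesis
      using convexD_alt[OF convex_Z a b] that by simp
  qed
  have "\<phi> 1 \<le> \<phi> 0"
  proof (rule DERIV_nonpos_imp_nonincreasing[of 0 1 \<phi>])
    fix t :: real assume t: "0 \<le> t" "t \<le> 1"
    let ?d = "(b - a) \<bullet> grad w (c t) - grad w a \<bullet> (b - a) - M * (p (b - a))\<^sup>2 * t"
    have dc: "(c has_derivative (\<lambda>h. h *\<^sub>R (b - a))) (at t)"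
      unfolding c_def by (auto intro!: derivative_eq_intros)
    have df: "(?f has_derivative (\<lambda>h. h \<bullet> grad w (c t))) (at (c t))"
      using distance_generating_gderiv[OF dgf] cZ[OF t] Z_interior by (auto simp: gderiv_def)
    have "((\<lambda>t. ?f (c t)) has_real_derivative (b - a) \<bullet> grad w (c t)) (at t)"
      using has_derivative_compose[OF dc df]
      by (simp add: has_field_derivative_def mult.commute[of _ "(b - a) \<bullet> grad w (c t)"] fun_eq_iff)
    then have "(\<phi> has_real_derivative ?d) (at t)"
      unfolding \<phi>_def by (auto intro!: derivative_eq_intros)
    moreover have "?d \<le> 0"
    proof -
      have "(grad w (c t) - grad w a) \<bullet> (b - a) \<le> M * p (c t - a) * p (b - a)"
        by (rule inner_le_dual_seminorm[OF semi grad_lipschitz[OF cZ[OF t] a]])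
      also have "p (c t - a) = t * p (b - a)"
        using semi t by (simp add: c_def seminorm_def)
      finally show ?thesis
        by (simp add: inner_diff_left inner_diff_right inner_commute power2_eq_square algebra_simps)
    qed
    ultimately show "\<exists>y. (\<phi> has_real_derivative y) (at t) \<and> y \<le> 0"
      by blast
  qed simp
  then show ?thesis
    using seminorm_minus_commute[OF semi, of a b] by (simp add: \<phi>_def c_def D_def)
qed

text \<open>The lower and upper quadratic bounds are compared at a single pair. If \<open>p\<close>
  vanished on all differences of points of \<open>Z\<close>, regularity would not relate
  \<open>m\<close> to \<open>M\<close>.\<close>

lemma m_le_M:
  assumes "a \<in> Z" "b \<in> Z" "p (a - b) \<noteq> 0"
  shows "m \<le> M"
  using order_trans[OF D_ge[OF assms(1,2)] D_le[OF assms(1,2)]] assms(3) by simp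

text \<open>The value of \<open>w\<close> at the second argument cancels, so the difference is
  affine in \<open>x\<close>.\<close>

lemma D_three_point: "D a x - D b x = D a y - D b y + (grad w a - grad w b) \<bullet> (y - x)"
  by (simp add: D_def inner_diff_left inner_diff_right)

lemma D_convex_combination:
  assumes S: "finite S" "\<And>i. i \<in> S \<Longrightarrow> 0 \<le> l i" "sum l S = 1" "\<And>i. i \<in> S \<Longrightarrow> x i \<in> Z"
  shows "D a (\<Sum>i\<in>S. l i *\<^sub>R x i) \<le> (\<Sum>i\<in>S. l i * D a (x i))"
proof -
  let ?y = "\<Sum>i\<in>S. l i *\<^sub>R x i"
  have y: "?y \<in> Z"
    using convex_sum[OF S(1) convex_Z S(3)] S(2,4) by blast
  \<comment> \<open>This is \<open>D ?y (x i) \<ge> 0\<close> rewritten: the tangent of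
    \<open>D a\<close> at the mean lies below. Averaging removes the linear term, as in Jensen's
    inequality.\<close>
  have le: "D a ?y + (grad w ?y - grad w a) \<bullet> (x i - ?y) \<le> D a (x i)" if "i \<in> S" for i
    using D_nonneg[OF y S(4)[OF that]]
    by (simp add: D_def inner_diff_left inner_diff_right)
  have "(\<Sum>i\<in>S. l i *\<^sub>R (x i - ?y)) = 0"
    by (simp add: scaleR_diff_right sum_subtractf scaleR_left.sum[symmetric] S(3))
  then have "(grad w ?y - grad w a) \<bullet> (\<Sum>i\<in>S. l i *\<^sub>R (x i - ?y)) = 0"
    by simp
  then have z: "(\<Sum>i\<in>S. l i * ((grad w ?y - grad w a) \<bullet> (x i - ?y))) = 0"
    by (simp only: inner_sum_right[of "grad w ?y - grad w a"] inner_scaleR_right)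
  have "D a ?y = (\<Sum>i\<in>S. l i * (D a ?y + (grad w ?y - grad w a) \<bullet> (x i - ?y)))"
    using z by (simp add: distrib_left sum.distrib sum_distrib_right[symmetric] S(3))
  also have "\<dots> \<le> (\<Sum>i\<in>S. l i * D a (x i))"
    by (intro sum_mono mult_left_mono le S(2))
  finally show ?thesis .
qed

end

section \<open>Enlargements of maximal monotone operators\<close>

text \<open>Adding \<open>v\<close> to \<open>T y\<close> keeps the operator monotone, so by
  maximality it changes nothing.\<close>

lemma maximal_monotone_memI:
  assumes T: "maximal_monotone T" and related: "\<And>x u. u \<in> T x \<Longrightarrow> 0 \<le> (u - v) \<bullet> (x - y)"
  shows "v \<in> T y"
proof -
  let ?S = "T(y := insert v (T y))"
  have mono: "monotone_op T"
    using T by (simp add: maximal_monotone_def)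
  have related': "0 \<le> (v - u) \<bullet> (y - x)" if "u \<in> T x" for x u
    using related[OF that] by (metis inner_minus_left inner_minus_right minus_diff_eq minus_minus)
  have "monotone_op ?S"
    using mono related related' unfolding monotone_op_def by auto
  moreover have "\<forall>x. T x \<subseteq> ?S x"
    by auto
  ultimately have "?S = T"
    using T unfolding maximal_monotone_def by blast
  then show ?thesis
    by (metis fun_upd_same insertI1)
qed

text \<open>The double sum of \<open>l i * l j * ((u i - u j) \<bullet> (x i - x j))\<close> is
  nonnegative and equals twice the difference of the two sides.\<close>

lemma monotone_weighted_sum_le:
  fixes u x :: "'i \<Rightarrow> 'a::real_inner"
  assumes S: "finite S" "\<And>i. i \<in> S \<Longrightarrow> 0 \<le> l i" "sum l S = 1"
    and mono: "\<And>i j. i \<in> S \<Longrightarrow> j \<in> S \<Longrightarrow> 0 \<le> (u i - u j) \<bullet> (x i - x j)"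
  shows "(\<Sum>i\<in>S. l i *\<^sub>R u i) \<bullet> (\<Sum>i\<in>S. l i *\<^sub>R x i) \<le> (\<Sum>i\<in>S. l i * (u i \<bullet> x i))"
proof -
  let ?U = "\<Sum>i\<in>S. l i *\<^sub>R u i" and ?X = "\<Sum>i\<in>S. l i *\<^sub>R x i" and ?P = "\<Sum>i\<in>S. l i * (u i \<bullet> x i)"
  have inner: "(\<Sum>j\<in>S. l j * ((u i - u j) \<bullet> (x i - x j))) = u i \<bullet> x i - u i \<bullet> ?X - ?U \<bullet> x i + ?P" for i
    by (simp add: inner_diff_left inner_diff_right algebra_simps sum.distrib sum_subtractf
        inner_sum_left inner_sum_right sum_distrib_left[symmetric] sum_distrib_right[symmetric] S(3))
  have "0 \<le> (\<Sum>i\<in>S. l i * (\<Sum>j\<in>S. l j * ((u i - u j) \<bullet> (x i - x j))))"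
    by (intro sum_nonneg mult_nonneg_nonneg S mono)
  also have "\<dots> = (\<Sum>i\<in>S. l i * (u i \<bullet> x i - u i \<bullet> ?X - ?U \<bullet> x i + ?P))"
    by (simp add: inner)
  also have "\<dots> = ?P - ?U \<bullet> ?X - ?U \<bullet> ?X + ?P"
  proof -
    have "(\<Sum>i\<in>S. l i * (u i \<bullet> ?X)) = ?U \<bullet> ?X"
      by (simp add: inner_sum_left)
    moreover have "(\<Sum>i\<in>S. l i * (?U \<bullet> x i)) = ?U \<bullet> ?X"
      by (simp only: inner_sum_right[of ?U] inner_scaleR_right)
    moreover have "(\<Sum>i\<in>S. l i * ?P) = ?P"
      by (simp only: sum_distrib_right[symmetric] S(3) mult_1)
    ultimately show ?thesis
      by (simp only: right_diff_distrib distrib_left sum.distrib sum_subtractf)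
  qed
  finally show ?thesis
    by simp
qed

text \<open>
  The Debrunner--Flor lemma. If every \<open>y\<close> were separated from the graph by some pair, finitely many
  such pairs would suffice on \<open>C\<close>, and a fixed point of the map averaging their base points with
  weights proportional to the separation gaps contradicts monotonicity.
\<close>
lemma debrunner_flor:
  fixes T :: "'a::euclidean_space \<Rightarrow> 'a set"
  assumes T: "monotone_op T" and C: "compact C" "convex C" "C \<noteq> {}" "Dom T \<subseteq> C"
    and \<phi>: "continuous_on UNIV \<phi>"
  obtains y where "y \<in> C" "\<And>x u. u \<in> T x \<Longrightarrow> 0 \<le> (u - \<phi> y) \<bullet> (x - y)"
proof (rule ccontr)
  assume "\<not> thesis"
  then have prem: "\<not> (\<forall>x u. u \<in> T x \<longrightarrow> 0 \<le> (u - \<phi> y) \<bullet> (x - y))" if "y \<in> C" for y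
    using that \<open>\<And>y. y \<in> C \<Longrightarrow> (\<And>x u. u \<in> T x \<Longrightarrow> 0 \<le> (u - \<phi> y) \<bullet> (x - y)) \<Longrightarrow> thesis\<close> by blast
  have sep: "\<exists>x u. u \<in> T x \<and> (u - \<phi> y) \<bullet> (x - y) < 0" if "y \<in> C" for y
    using prem[OF that] by (meson not_le_imp_less)
  let ?G = "{(x, u). u \<in> T x}"
  define h where "h q y = (snd q - \<phi> y) \<bullet> (fst q - y)" for q y
  have h_cont: "continuous_on A (h q)" for A q
    unfolding h_def
    by (intro continuous_intros continuous_on_subset[OF \<phi>]) auto
  have "open {y. h q y < 0}" for q
    by (intro open_Collect_less h_cont continuous_intros)
  moreover have "C \<subseteq> (\<Union>q\<in>?G. {y. h q y < 0})"
    using sep by (fastforce simp: h_def)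
  ultimately obtain Q where Q: "Q \<subseteq> ?G" "finite Q" "C \<subseteq> (\<Union>q\<in>Q. {y. h q y < 0})"
    using compactE_image[OF C(1)] by metis
  define g where "g q y = max 0 (- h q y)" for q y
  define s where "s y = (\<Sum>q\<in>Q. g q y)" for y
  have g_nonneg: "0 \<le> g q y" for q y
    by (simp add: g_def)
  have s_pos: "0 < s y" if "y \<in> C" for y
  proof -
    obtain q where "q \<in> Q" "h q y < 0"
      using Q(3) \<open>y \<in> C\<close> by blast
    then show ?thesis
      unfolding s_def by (intro sum_pos2[of Q q]) (auto simp: Q(2) g_def)
  qed
  define \<beta> where "\<beta> q y = g q y / s y" for q y
  have \<beta>_nonneg: "0 \<le> \<beta> q y" if "y \<in> C" for q y
    using s_pos[OF that] by (simp add: \<beta>_def g_nonneg)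
  have \<beta>_sum: "(\<Sum>q\<in>Q. \<beta> q y) = 1" if "y \<in> C" for y
    using s_pos[OF that] by (simp add: \<beta>_def s_def flip: sum_divide_distrib)
  have fst_Q: "fst q \<in> C" if "q \<in> Q" for q
    using subsetD[OF Q(1) that] C(4) by (auto simp: Dom_def)
  have "continuous_on C (\<lambda>y. \<Sum>q\<in>Q. \<beta> q y *\<^sub>R fst q)"
    unfolding \<beta>_def g_def s_def
    using s_pos[unfolded s_def g_def]
    by (intro continuous_intros h_cont) (auto simp: less_imp_neq[symmetric])
  moreover have "(\<lambda>y. \<Sum>q\<in>Q. \<beta> q y *\<^sub>R fst q) \<in> C \<rightarrow> C"
    by (auto intro!: convex_sum Q C \<beta>_sum \<beta>_nonneg fst_Q)
  ultimately obtain y where y: "y \<in> C" "(\<Sum>q\<in>Q. \<beta> q y *\<^sub>R fst q) = y"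
    by (rule brouwer[OF C(1-3)])
  have "(\<Sum>q\<in>Q. \<beta> q y *\<^sub>R (snd q - \<phi> y)) \<bullet> (\<Sum>q\<in>Q. \<beta> q y *\<^sub>R (fst q - y))
      \<le> (\<Sum>q\<in>Q. \<beta> q y * ((snd q - \<phi> y) \<bullet> (fst q - y)))"
  proof (rule monotone_weighted_sum_le)
    fix q q' assume "q \<in> Q" "q' \<in> Q"
    then have "snd q \<in> T (fst q)" "snd q' \<in> T (fst q')"
      using Q(1) by auto
    then show "0 \<le> (snd q - \<phi> y - (snd q' - \<phi> y)) \<bullet> (fst q - y - (fst q' - y))"
      using T by (simp add: monotone_op_def)
  qed (use Q(2) \<beta>_nonneg \<beta>_sum y(1) in auto)
  \<comment> \<open>The fixed point equation kills the left side of the inequality, so the weighted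
    gaps sum to something nonnegative. Yet weights vanish wherever \<open>h q y \<ge> 0\<close>, and
    some gap is strictly negative.\<close>
  moreover have "(\<Sum>q\<in>Q. \<beta> q y *\<^sub>R (fst q - y)) = 0"
    using y \<beta>_sum by (simp add: scaleR_diff_right sum_subtractf scaleR_left.sum[symmetric])
  ultimately have "0 \<le> (\<Sum>q\<in>Q. \<beta> q y * h q y)"
    by (simp add: h_def)
  moreover have "(\<Sum>q\<in>Q. \<beta> q y * h q y) < 0"
  proof -
    obtain q where q: "q \<in> Q" "h q y < 0"
      using Q(3) y by blast
    have "0 < (\<Sum>q\<in>Q. - (\<beta> q y * h q y))"
    proof (rule sum_pos2[of Q q])
      show "0 < - (\<beta> q y * h q y)"
        using q(2) s_pos[OF y(1)] by (simp add: \<beta>_def g_def mult_neg_neg)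
      show "0 \<le> - (\<beta> q' y * h q' y)" for q'
        using s_pos[OF y(1)]
        by (auto simp: \<beta>_def g_def max_def mult_nonneg_nonpos divide_nonneg_pos divide_nonpos_pos)
    qed (use Q q in auto)
    then show ?thesis
      by (simp add: sum_negf)
  qed
  ultimately show False
    by simp
qed

text \<open>The auxiliary point \<open>y\<close> is the resolvent of \<open>T\<close> with parameter
  \<open>1 / c\<close> at \<open>x + v / c\<close>; it tends to \<open>x\<close> as \<open>c\<close>
  grows. Debrunner-Flor with maximality supplies it.\<close>

lemma enlargement_in_closure_Dom:
  fixes T :: "'a::euclidean_space \<Rightarrow> 'a set"
  assumes T: "maximal_monotone T" and bdd: "bounded (Dom T)" and ne: "Dom T \<noteq> {}"
    and v: "v \<in> enlargement T \<epsilon> x"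
  shows "x \<in> closure (Dom T)"
proof (subst closure_approachable, intro allI impI)
  fix e :: real assume "0 < e"
  \<comment> \<open>Large enough for \<open>\<epsilon> < c * e\<^sup>2\<close>, and positive
    whatever the sign of \<open>\<epsilon>\<close>.\<close>
  define c where "c = (\<bar>\<epsilon>\<bar> + 1) / e\<^sup>2"
  have c: "0 < c"
    using \<open>0 < e\<close> by (simp add: c_def)
  let ?C = "closure (convex hull (Dom T))" and ?\<phi> = "\<lambda>y. v + c *\<^sub>R (x - y)"
  have "bounded (convex hull (Dom T))"
    using bdd by (rule bounded_convex_hull)
  moreover have "Dom T \<subseteq> convex hull (Dom T)"
    by (rule hull_subset)
  then have "Dom T \<subseteq> ?C"
    using closure_subset by blast
  ultimately obtain y where "\<And>x u. u \<in> T x \<Longrightarrow> 0 \<le> (u - ?\<phi> y) \<bullet> (x - y)"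
  proof (rule_tac debrunner_flor[of T ?C ?\<phi>])
    show "monotone_op T"
      using T by (simp add: maximal_monotone_def)
    show "?C \<noteq> {}"
      using ne by simp
    show "continuous_on UNIV ?\<phi>"
      by (intro continuous_intros)
  qed (auto intro: convex_closure)
  then have y: "?\<phi> y \<in> T y"
    using maximal_monotone_memI[OF T] by blast
  then have "- \<epsilon> \<le> (v - ?\<phi> y) \<bullet> (x - y)"
    using v unfolding enlargement_def by blast
  then have "c * (dist y x)\<^sup>2 \<le> \<epsilon>"
    by (simp add: dist_norm norm_minus_commute[of y] power2_norm_eq_inner)
  also have "\<epsilon> < c * e\<^sup>2"
    using \<open>0 < e\<close> by (simp add: c_def)
  finally have "dist y x < e"
    using c \<open>0 < e\<close> by (simp add: power2_less_imp_less)
  then show "\<exists>y\<in>Dom T. dist y x < e"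
    using y by (auto simp: Dom_def)
qed

section \<open>Ergodic convergence of the NE-HPE framework\<close>

text \<open>The defining inequalities of the individual enlargements are averaged;
  \<open>ergodic_eps\<close> collects the errors and the correlation between residuals and
  points.\<close>

lemma ergodic_mem_enlargement:
  assumes L: "0 < Lam lam k" and lam: "\<And>i. i \<in> {1..k} \<Longrightarrow> 0 \<le> lam i"
    and r: "\<And>i. i \<in> {1..k} \<Longrightarrow> r i \<in> enlargement T (eps i) (zt i)"
  shows "ergodic lam r k \<in> enlargement T (ergodic_eps lam eps r zt k) (ergodic lam zt k)"
  unfolding enlargement_def
proof (intro CollectI allI ballI)
  fix x u assume u: "u \<in> T x"
  let ?L = "Lam lam k" and ?R = "ergodic lam r k" and ?Y = "ergodic lam zt k"
  have sumR: "(\<Sum>i=1..k. lam i *\<^sub>R r i) = ?L *\<^sub>R ?R" and sumY: "(\<Sum>i=1..k. lam i *\<^sub>R zt i) = ?L *\<^sub>R ?Y"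
    using L by (simp_all add: ergodic_def)
  have "(\<Sum>i=1..k. lam i * (- eps i)) \<le> (\<Sum>i=1..k. lam i * ((r i - u) \<bullet> (zt i - x)))"
    using r u lam by (intro sum_mono mult_left_mono) (auto simp: enlargement_def)
  \<comment> \<open>Splitting at the mean \<open>?Y\<close> leaves one sum that belongs to
    \<open>ergodic_eps\<close>; the other three collapse to expressions in the averages.\<close>
  also have "\<dots> = (\<Sum>i=1..k. lam i * (r i \<bullet> (zt i - ?Y)) + (lam i *\<^sub>R r i) \<bullet> (?Y - x)
      - u \<bullet> (lam i *\<^sub>R zt i) + lam i * (u \<bullet> x))"
    by (intro sum.cong) (simp_all add: inner_diff_left inner_diff_right algebra_simps)
  also have "\<dots> = (\<Sum>i=1..k. lam i * (r i \<bullet> (zt i - ?Y))) + ?L * (?R \<bullet> (?Y - x))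
      - ?L * (u \<bullet> ?Y) + ?L * (u \<bullet> x)"
  proof -
    have "(\<Sum>i=1..k. (lam i *\<^sub>R r i) \<bullet> (?Y - x)) = ?L * (?R \<bullet> (?Y - x))"
      by (simp only: inner_sum_left[symmetric] sumR) simp
    moreover have "(\<Sum>i=1..k. u \<bullet> (lam i *\<^sub>R zt i)) = ?L * (u \<bullet> ?Y)"
      by (simp only: inner_sum_right[symmetric] sumY) simp
    moreover have "(\<Sum>i=1..k. lam i * (u \<bullet> x)) = ?L * (u \<bullet> x)"
      by (simp only: sum_distrib_right[symmetric] Lam_def)
    ultimately show ?thesis
      by (simp only: sum.distrib sum_subtractf)
  qed
  finally have "- (\<Sum>i=1..k. lam i * (eps i + r i \<bullet> (zt i - ?Y))) \<le> ?L * ((?R - u) \<bullet> (?Y - x))"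
    by (simp add: inner_diff_left inner_diff_right algebra_simps sum.distrib sum_subtractf sum_negf)
  moreover have "(\<Sum>i=1..k. lam i * (eps i + r i \<bullet> (zt i - ?Y))) = ?L * ergodic_eps lam eps r zt k"
    using L by (simp add: ergodic_eps_def)
  ultimately have "?L * (- ergodic_eps lam eps r zt k) \<le> ?L * ((?R - u) \<bullet> (?Y - x))"
    by simp
  then show "- ergodic_eps lam eps r zt k \<le> (?R - u) \<bullet> (?Y - x)"
    using L by (simp only: mult_le_cancel_left_pos)
qed

section \<open>Estimates along a run, relative to a fixed zero of the operator\<close>

locale ne_hpe_run = regular_dgf w Z p m M
  for w :: "'a::euclidean_space \<Rightarrow> ereal" and Z p m M +
  fixes T :: "'a \<Rightarrow> 'a set" and \<sigma> :: real and zt z r :: "nat \<Rightarrow> 'a" and eps lam eta :: "nat \<Rightarrow> real"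
  assumes T: "maximal_monotone T" and Dom_subset: "Dom T \<subseteq> Z" and zeros_ne: "zeros T \<noteq> {}"
    and run: "ne_hpe w Z T \<sigma> zt z r eps lam eta"
begin

lemma sigma: "0 \<le> \<sigma>" "\<sigma> \<le> 1" and eta_nonneg: "0 \<le> eta k"
  and lam_pos: "1 \<le> k \<Longrightarrow> 0 < lam k" and zt_Z: "1 \<le> k \<Longrightarrow> zt k \<in> Z" and z_Z: "z k \<in> Z"
  and r_enlargement: "1 \<le> k \<Longrightarrow> r k \<in> enlargement T (eps k) (zt k)"
  using run by (cases "k = 0"; simp add: ne_hpe_def)+

lemma zeros_Z: "zs \<in> zeros T \<Longrightarrow> zs \<in> Z"
  using Dom_subset by (auto simp: zeros_def Dom_def)

lemma Lam_pos:
  assumes "1 \<le> k"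
  shows "0 < Lam lam k"
  unfolding Lam_def using assms lam_pos by (intro sum_pos) auto

lemma scaled_residual:
  assumes "1 \<le> k"
  shows "lam k *\<^sub>R r k = grad w (z (k - 1)) - grad w (z k)"
proof -
  have "r k = (1 / lam k) *\<^sub>R grad (bregman w (z k)) (z (k - 1))"
    using run assms by (simp add: ne_hpe_def)
  moreover have "grad (bregman w (z k)) (z (k - 1)) = grad w (z (k - 1)) - grad w (z k)"
    using grad_bregman[OF dgf] z_Z Z_interior by blast
  ultimately show ?thesis
    using lam_pos[OF assms] by simp
qed

lemma error_criterion:
  assumes "1 \<le> k"
  shows "D (z k) (zt k) + lam k * eps k + eta k \<le> \<sigma> * D (z (k - 1)) (zt k) + eta (k - 1)"
proof -
  have "bregman w (z k) (zt k) + ereal (lam k * eps k + eta k)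
      \<le> ereal \<sigma> * bregman w (z (k - 1)) (zt k) + ereal (eta (k - 1))"
    using run assms by (simp add: ne_hpe_def)
  then show ?thesis
    by (simp add: bregman_eq_D z_Z zt_Z[OF assms])
qed

text \<open>The three-point identity compares \<open>x\<close> with \<open>zt k\<close>, and the
  error criterion bounds the terms at \<open>zt k\<close>. Keeping \<open>x\<close> free serves both
  zeros and the ergodic mean.\<close>

lemma descent:
  assumes "1 \<le> k"
  shows "D (z k) x + eta k + (1 - \<sigma>) * D (z (k - 1)) (zt k) + lam k * (eps k + r k \<bullet> (zt k - x))
    \<le> D (z (k - 1)) x + eta (k - 1)"
proof -
  have "D (z (k - 1)) x - D (z k) x
      = D (z (k - 1)) (zt k) - D (z k) (zt k) + (lam k *\<^sub>R r k) \<bullet> (zt k - x)"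
    unfolding scaled_residual[OF assms] by (rule D_three_point)
  then show ?thesis
    using error_criterion[OF assms] by (simp add: algebra_simps)
qed

lemma descent_zeros:
  assumes k: "1 \<le> k" and zs: "zs \<in> zeros T"
  shows "D (z k) zs + eta k + (1 - \<sigma>) * D (z (k - 1)) (zt k) \<le> D (z (k - 1)) zs + eta (k - 1)"
proof -
  \<comment> \<open>The enlargement inequality is tested on the pair \<open>(zs, 0)\<close> of the
    graph.\<close>
  have "- eps k \<le> (r k - 0) \<bullet> (zt k - zs)"
    using r_enlargement[OF k] zs unfolding enlargement_def zeros_def by blast
  then have "0 \<le> lam k * (eps k + r k \<bullet> (zt k - zs))"
    using lam_pos[OF k] by simp
  then show ?thesis
    using descent[OF k, of zs] by simp
qed

lemma D_step_nonneg: "1 \<le> k \<Longrightarrow> 0 \<le> D (z (k - 1)) (zt k)"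
  by (simp add: D_nonneg z_Z zt_Z)

lemma fejer:
  assumes "zs \<in> zeros T"
  shows "D (z k) zs + eta k \<le> D (z 0) zs + eta 0"
proof (induction k)
  case (Suc k)
  have "0 \<le> (1 - \<sigma>) * D (z (Suc k - 1)) (zt (Suc k))"
    using D_step_nonneg[of "Suc k"] sigma by simp
  then show ?case
    using descent_zeros[of "Suc k", OF _ assms] Suc by simp
qed simp

lemma telescoped_residual: "(\<Sum>i=1..k. lam i *\<^sub>R r i) = grad w (z 0) - grad w (z k)"
proof (induction k)
  case (Suc k)
  then show ?case
    using scaled_residual[of "Suc k"] by simp
qed simp

lemma telescoped_descent:
  "D (z k) x + eta k + (\<Sum>i=1..k. lam i * (eps i + r i \<bullet> (zt i - x))) \<le> D (z 0) x + eta 0"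
proof (induction k)
  case (Suc k)
  have "0 \<le> (1 - \<sigma>) * D (z (Suc k - 1)) (zt (Suc k))"
    using D_step_nonneg[of "Suc k"] sigma by simp
  then show ?case
    using descent[of "Suc k" x] Suc by simp
qed simp

lemma p_z_zeros_le:
  assumes zs: "zs \<in> zeros T"
  shows "p (z k - zs) \<le> sqrt 2 * sqrt (D (z 0) zs + eta 0) / sqrt m"
proof -
  have "m / 2 * (p (z k - zs))\<^sup>2 \<le> D (z 0) zs + eta 0"
    using D_ge[OF z_Z zeros_Z[OF zs]] fejer[OF zs] eta_nonneg by (smt (verit))
  then have "(p (z k - zs))\<^sup>2 \<le> 2 * (D (z 0) zs + eta 0) / m"
    using m_pos by (simp add: field_simps)
  then have "p (z k - zs) \<le> sqrt (2 * (D (z 0) zs + eta 0) / m)"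
    by (rule real_le_rsqrt)
  then show ?thesis
    by (simp only: real_sqrt_mult real_sqrt_divide)
qed

text \<open>The weighted residuals sum to a gradient difference between \<open>z 0\<close> and
  \<open>z k\<close>. Both points lie within the same \<open>p\<close>-radius of \<open>zs\<close>,
  hence the factor 2.\<close>

lemma dual_residual_le:
  assumes k: "1 \<le> k" and zs: "zs \<in> zeros T"
  shows "dual_seminorm p (ergodic lam r k)
    \<le> ereal (2 * sqrt 2 * M * sqrt (D (z 0) zs + eta 0) / (sqrt m * Lam lam k))"
  unfolding dual_seminorm_le_iff
proof (intro allI impI)
  fix v assume v: "p v \<le> 1"
  let ?s = "sqrt 2 * sqrt (D (z 0) zs + eta 0) / sqrt m"
  have "p (z 0 - z k) \<le> ?s + ?s"
    using seminorm_diff_triangle[OF semi, of "z 0" "z k" zs] p_z_zeros_le[OF zs, of 0]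
      p_z_zeros_le[OF zs, of k] seminorm_minus_commute[OF semi, of zs "z k"] by linarith
  then have "M * p (z 0 - z k) \<le> M * (2 * ?s)"
    using M_pos by (intro mult_left_mono) linarith+
  moreover have "(grad w (z 0) - grad w (z k)) \<bullet> v \<le> M * p (z 0 - z k)"
    using grad_lipschitz[OF z_Z z_Z, of 0 k] v by (simp add: dual_seminorm_le_iff)
  ultimately have "(grad w (z 0) - grad w (z k)) \<bullet> v / Lam lam k \<le> M * (2 * ?s) / Lam lam k"
    using Lam_pos[OF k] by (intro divide_right_mono) linarith+
  then show "ergodic lam r k \<bullet> v \<le> 2 * sqrt 2 * M * sqrt (D (z 0) zs + eta 0) / (sqrt m * Lam lam k)"
    unfolding ergodic_def telescoped_residual by (simp add: mult_ac)
qed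

lemma ergodic_convex_combination:
  assumes "1 \<le> k"
  shows "ergodic lam zt k = (\<Sum>i=1..k. (lam i / Lam lam k) *\<^sub>R zt i)"
    and "(\<Sum>i=1..k. lam i / Lam lam k) = 1"
  using Lam_pos[OF assms]
  by (simp_all add: ergodic_def scaleR_sum_right flip: sum_divide_distrib) (simp add: Lam_def)

text \<open>The path from \<open>z 0\<close> through \<open>zs\<close> and \<open>z i\<close> to
  \<open>zt i\<close> has three legs, and squaring their sum costs a factor 3. Passing from
  \<open>D\<close> to \<open>p\<close> and back costs \<open>M / m\<close>.\<close>

lemma D_zt_le:
  assumes i: "1 \<le> i" and zs: "zs \<in> zeros T" and R: "D (z (i - 1)) (zt i) \<le> R"
  shows "D (z 0) (zt i) \<le> 3 * M / m * (3 * D (z 0) zs + 2 * eta 0 + \<sigma> * R)"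
proof -
  let ?a = "p (z 0 - zs)" and ?b = "p (z i - zs)" and ?c = "p (z i - zt i)"
  have "p (z 0 - zt i) \<le> ?a + ?b + ?c"
    using seminorm_diff_triangle[OF semi, of "z 0" "zt i" zs]
      seminorm_diff_triangle[OF semi, of zs "zt i" "z i"]
      seminorm_minus_commute[OF semi, of zs "z i"] by linarith
  then have "(p (z 0 - zt i))\<^sup>2 \<le> (?a + ?b + ?c)\<^sup>2"
    by (intro power_mono p_nonneg)
  also have "\<dots> \<le> 3 * (?a\<^sup>2 + ?b\<^sup>2 + ?c\<^sup>2)"
  proof -
    have "0 \<le> (?a - ?b)\<^sup>2 + (?b - ?c)\<^sup>2 + (?a - ?c)\<^sup>2"
      by simp
    then show ?thesis
      by (simp add: power2_eq_square algebra_simps)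
  qed
  also have "\<dots> \<le> 3 * (2 / m * (3 * D (z 0) zs + 2 * eta 0 + \<sigma> * R))"
  proof -
    \<comment> \<open>The first leg costs \<open>D (z 0) zs\<close>, the second
      \<open>D (z 0) zs + eta 0\<close>, the third \<open>\<sigma> * R + eta (i - 1)\<close>, where
      \<open>eta (i - 1)\<close> is again at most \<open>D (z 0) zs + eta 0\<close>.\<close>
    have "D (z i) zs + eta i \<le> D (z 0) zs + eta 0" "D (z (i - 1)) zs + eta (i - 1) \<le> D (z 0) zs + eta 0"
      by (intro fejer zs)+
    moreover have "0 \<le> eta i" "0 \<le> D (z (i - 1)) zs"
      by (auto intro!: eta_nonneg D_nonneg z_Z zeros_Z zs)
    moreover have "\<sigma> * D (z (i - 1)) (zt i) \<le> \<sigma> * R"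
      using R sigma by (intro mult_left_mono) auto
    moreover have "0 \<le> lam i * eps i"
      using run i less_imp_le[OF lam_pos[OF i]] by (auto simp: ne_hpe_def intro!: mult_nonneg_nonneg)
    ultimately have "m / 2 * ?a\<^sup>2 + m / 2 * ?b\<^sup>2 + m / 2 * ?c\<^sup>2 \<le> 3 * D (z 0) zs + 2 * eta 0 + \<sigma> * R"
      using error_criterion[OF i] D_ge[OF z_Z zeros_Z[OF zs], of 0] D_ge[OF z_Z zeros_Z[OF zs], of i]
        D_ge[OF z_Z zt_Z[OF i], of i] by linarith
    then show ?thesis
      using m_pos by (simp add: field_simps)
  qed
  finally have "M / 2 * (p (z 0 - zt i))\<^sup>2 \<le> M / 2 * (3 * (2 / m * (3 * D (z 0) zs + 2 * eta 0 + \<sigma> * R)))"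
    using M_pos by (intro mult_left_mono) auto
  also have "\<dots> = 3 * M / m * (3 * D (z 0) zs + 2 * eta 0 + \<sigma> * R)"
    using m_pos by (simp add: field_simps)
  finally show ?thesis
    using D_le[OF z_Z zt_Z[OF i], of 0] by linarith
qed

lemma ergodic_eps_le:
  assumes k: "1 \<le> k" and mM: "m \<le> M" and zs: "zs \<in> zeros T"
    and R: "\<And>i. i \<in> {1..k} \<Longrightarrow> D (z (i - 1)) (zt i) \<le> R"
  shows "ergodic_eps lam eps r zt k \<le> 3 * M / m * ((3 * (D (z 0) zs + eta 0) + \<sigma> * R) / Lam lam k)"
proof -
  let ?y = "ergodic lam zt k" and ?B = "3 * M / m * (3 * D (z 0) zs + 2 * eta 0 + \<sigma> * R)"
  note L = Lam_pos[OF k]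
  have y: "?y \<in> Z"
    unfolding ergodic_convex_combination(1)[OF k]
    using convex_sum[OF _ convex_Z ergodic_convex_combination(2)[OF k]] lam_pos zt_Z L by (simp add: less_imp_le)
  have "D (z 0) ?y \<le> (\<Sum>i=1..k. lam i / Lam lam k * D (z 0) (zt i))"
    unfolding ergodic_convex_combination(1)[OF k]
    by (rule D_convex_combination) (use lam_pos zt_Z L ergodic_convex_combination(2)[OF k] in \<open>auto simp: less_imp_le\<close>)
  also have "\<dots> \<le> (\<Sum>i=1..k. lam i / Lam lam k * ?B)"
    using R lam_pos L by (intro sum_mono mult_left_mono D_zt_le zs) (auto simp: less_imp_le)
  also have "\<dots> = ?B"
    by (simp only: sum_distrib_right[symmetric] ergodic_convex_combination(2)[OF k] mult_1)
  finally have "D (z 0) ?y \<le> ?B" .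
  \<comment> \<open>The telescoped descent contributes a third \<open>eta 0\<close>, outside the
    factor \<open>3 * M / m\<close>; moving it inside is where \<open>m \<le> M\<close>
    enters.\<close>
  moreover have "eta 0 \<le> 3 * M / m * eta 0"
    using mM m_pos eta_nonneg[of 0] mult_right_mono[of 1 "3 * M / m" "eta 0"] by simp
  moreover have "0 \<le> D (z k) ?y + eta k"
    using D_nonneg[OF z_Z y] eta_nonneg by simp
  ultimately have "(\<Sum>i=1..k. lam i * (eps i + r i \<bullet> (zt i - ?y))) \<le> ?B + 3 * M / m * eta 0"
    using telescoped_descent[of k ?y] by linarith
  also have "\<dots> = 3 * M / m * (3 * (D (z 0) zs + eta 0) + \<sigma> * R)"
    by (simp add: algebra_simps add_divide_distrib)
  finally show ?thesis
    using divide_right_mono[OF _ less_imp_le[OF L]] by (fastforce simp: ergodic_eps_def)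
qed

text \<open>The term with \<open>1 - \<sigma>\<close> that \<open>fejer\<close> discards is kept for
  the single step \<open>k\<close>.\<close>

lemma step_le_of_contraction:
  assumes "\<sigma> < 1" "1 \<le> k" "zs \<in> zeros T"
  shows "D (z (k - 1)) (zt k) \<le> (D (z 0) zs + eta 0) / (1 - \<sigma>)"
proof -
  have "0 \<le> D (z k) zs + eta k"
    using D_nonneg[OF z_Z zeros_Z[OF assms(3)]] eta_nonneg by simp
  then have "(1 - \<sigma>) * D (z (k - 1)) (zt k) \<le> D (z 0) zs + eta 0"
    using descent_zeros[OF assms(2,3)] fejer[OF assms(3), of "k - 1"] by linarith
  then show ?thesis
    using assms(1) by (simp add: field_simps)
qed

lemma p_le_of_closure:
  assumes x: "x \<in> closure S" and le: "\<And>y. y \<in> S \<Longrightarrow> p (a - y) \<le> K"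
  shows "p (a - x) \<le> K"
proof (rule field_le_epsilon)
  fix e :: real assume "0 < e"
  obtain C where C: "0 \<le> C" "\<And>x. p x \<le> C * norm x"
    using seminorm_le_norm[OF semi] by blast
  \<comment> \<open>\<open>C + 1\<close> guards against \<open>C = 0\<close>.\<close>
  obtain y where y: "y \<in> S" "dist y x < e / (C + 1)"
    using x \<open>0 < e\<close> C(1) unfolding closure_approachable
    by (meson add_nonneg_pos divide_pos_pos zero_less_one)
  have "C * dist y x \<le> (C + 1) * dist y x"
    by (simp add: mult_right_mono)
  also have "\<dots> \<le> e"
    using y(2) C(1) by (simp add: field_simps)
  finally have "p (y - x) \<le> e"
    using C(2)[of "y - x"] by (simp add: dist_norm)
  then show "p (a - x) \<le> K + e"
    using le[OF y(1)] seminorm_diff_triangle[OF semi, of a x y] by linarith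
qed

text \<open>The diameter controls points of \<open>Dom T\<close> only, so the
  \<open>p\<close>-distance to \<open>zs\<close> is bounded there and then extended to
  \<open>zt k\<close> in the closure. A squared triangle inequality through \<open>zs\<close>
  finishes.\<close>

lemma step_le_of_bounded_Dom:
  assumes bdd: "bounded (Dom T)" and k: "1 \<le> k" and zs: "zs \<in> zeros T"
    and d: "\<And>y y'. y \<in> Dom T \<Longrightarrow> y' \<in> Dom T \<Longrightarrow> min (D y y') (D y' y) \<le> d"
  shows "D (z (k - 1)) (zt k) \<le> 2 * M / m * (D (z 0) zs + eta 0 + d)"
proof -
  have zsD: "zs \<in> Dom T"
    using zs by (auto simp: zeros_def Dom_def)
  have "p (zs - y) \<le> sqrt (2 / m * d)" if y: "y \<in> Dom T" for y
  proof (rule real_le_rsqrt)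
    \<comment> \<open>The quadratic lower bound is symmetric, so even the smaller of the two
      distances dominates it.\<close>
    have "m / 2 * (p (zs - y))\<^sup>2 \<le> min (D zs y) (D y zs)"
      using D_ge[of zs y] D_ge[of y zs] y zsD Dom_subset seminorm_minus_commute[OF semi, of zs y]
      by auto
    also have "\<dots> \<le> d"
      by (rule d[OF zsD y])
    finally show "(p (zs - y))\<^sup>2 \<le> 2 / m * d"
      using m_pos by (simp add: field_simps)
  qed
  then have le: "p (zs - zt k) \<le> sqrt (2 / m * d)"
    using p_le_of_closure enlargement_in_closure_Dom[OF T bdd _ r_enlargement[OF k]] zsD by blast
  have "0 \<le> d"
    using d[OF zsD zsD] D_nonneg zeros_Z[OF zs] by fastforce
  then have b: "(p (zs - zt k))\<^sup>2 \<le> 2 / m * d"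
    using power_mono[OF le p_nonneg, of 2] m_pos by simp
  have "m / 2 * (p (z (k - 1) - zs))\<^sup>2 \<le> D (z 0) zs + eta 0"
    using D_ge[OF z_Z zeros_Z[OF zs], of "k - 1"] fejer[OF zs, of "k - 1"] eta_nonneg[of "k - 1"]
    by linarith
  then have a: "(p (z (k - 1) - zs))\<^sup>2 \<le> 2 / m * (D (z 0) zs + eta 0)"
    using m_pos by (simp add: field_simps)
  have "(p (z (k - 1) - zt k))\<^sup>2 \<le> (p (z (k - 1) - zs) + p (zs - zt k))\<^sup>2"
    by (intro power_mono p_nonneg seminorm_diff_triangle[OF semi])
  also have "\<dots> \<le> 2 * ((p (z (k - 1) - zs))\<^sup>2 + (p (zs - zt k))\<^sup>2)"
    using sum_squares_ge_zero[of "p (z (k - 1) - zs) - p (zs - zt k)" 0]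
    by (simp add: power2_eq_square algebra_simps)
  also have "\<dots> \<le> 2 * (2 / m * (D (z 0) zs + eta 0 + d))"
    using a b by (simp add: distrib_left)
  finally have "M / 2 * (p (z (k - 1) - zt k))\<^sup>2 \<le> M / 2 * (2 * (2 / m * (D (z 0) zs + eta 0 + d)))"
    using M_pos by (intro mult_left_mono) auto
  also have "\<dots> = 2 * M / m * (D (z 0) zs + eta 0 + d)"
    using m_pos by (simp add: field_simps)
  finally show ?thesis
    using D_le[OF z_Z zt_Z[OF k], of "k - 1"] by linarith
qed

section \<open>Passage to the infimum over zeros and to extended reals\<close>

lemma dw0_eq_ereal:
  obtains d where "dw0 w T (z 0) = ereal d" "0 \<le> d"
    "\<And>c. (\<And>zs. zs \<in> zeros T \<Longrightarrow> c \<le> D (z 0) zs) \<Longrightarrow> c \<le> d"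
proof -
  have eq: "dw0 w T (z 0) = (INF zs\<in>zeros T. ereal (D (z 0) zs))"
    unfolding dw0_def by (intro INF_cong refl bregman_eq_D z_Z zeros_Z)
  have ge: "ereal c \<le> dw0 w T (z 0)" if "\<And>zs. zs \<in> zeros T \<Longrightarrow> c \<le> D (z 0) zs" for c
    unfolding eq using that by (intro INF_greatest) simp
  obtain zs where zs: "zs \<in> zeros T"
    using zeros_ne by blast
  have "dw0 w T (z 0) \<le> ereal (D (z 0) zs)"
    unfolding eq using zs by (rule INF_lower)
  moreover have nonneg: "ereal 0 \<le> dw0 w T (z 0)"
    by (intro ge D_nonneg z_Z zeros_Z)
  ultimately obtain d where "dw0 w T (z 0) = ereal d"
    by (cases "dw0 w T (z 0)") auto
  with nonneg ge show ?thesis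
    by (intro that[of d]) auto
qed

lemma rho_eq_ereal:
  assumes "1 \<le> k"
  obtains R where "rho w z zt k = ereal R" "0 \<le> R"
    "\<And>i. i \<in> {1..k} \<Longrightarrow> D (z (i - 1)) (zt i) \<le> R"
    "\<And>c. (\<And>i. i \<in> {1..k} \<Longrightarrow> D (z (i - 1)) (zt i) \<le> c) \<Longrightarrow> R \<le> c"
proof
  let ?A = "(\<lambda>i. D (z (i - 1)) (zt i)) ` {1..k}"
  have "(\<lambda>i. bregman w (z (i - 1)) (zt i)) ` {1..k} = ereal ` ?A"
    by (auto simp: image_image bregman_eq_D z_Z zt_Z intro!: image_cong)
  moreover have "Max (ereal ` ?A) = ereal (Max ?A)"
    using assms by (intro mono_Max_commute[symmetric]) (auto simp: mono_def)
  ultimately show "rho w z zt k = ereal (Max ?A)"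
    by (simp add: rho_def)
  show le: "D (z (i - 1)) (zt i) \<le> Max ?A" if "i \<in> {1..k}" for i
    using that by (intro Max_ge) auto
  show "0 \<le> Max ?A"
    using le[of 1] D_step_nonneg[of 1] assms by simp
  show "Max ?A \<le> c" if "\<And>i. i \<in> {1..k} \<Longrightarrow> D (z (i - 1)) (zt i) \<le> c" for c
    using that assms by (intro Max.boundedI) auto
qed

lemma breg_diameter_eq_ereal:
  assumes "bounded (Dom T)"
  obtains d where "breg_diameter w (Dom T) = ereal d"
    "\<And>y y'. y \<in> Dom T \<Longrightarrow> y' \<in> Dom T \<Longrightarrow> min (D y y') (D y' y) \<le> d"
proof -
  let ?d = "breg_diameter w (Dom T)"
  have breg: "min (bregman w y y') (bregman w y' y) = ereal (min (D y y') (D y' y))"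
    if "y \<in> Dom T" "y' \<in> Dom T" for y y'
    using that Dom_subset by (simp add: bregman_eq_D subset_iff)
  have upper: "ereal (min (D y y') (D y' y)) \<le> ?d" if "y \<in> Dom T" "y' \<in> Dom T" for y y'
    unfolding breg_diameter_def using that by (intro SUP_upper2[of "(y, y')"]) (auto simp: breg)
  obtain C where C: "0 \<le> C" "\<And>x. p x \<le> C * norm x"
    using seminorm_le_norm[OF semi] by blast
  obtain N where N: "\<And>x. x \<in> Dom T \<Longrightarrow> norm x \<le> N"
    using assms by (auto simp: bounded_iff)
  have "min (D y y') (D y' y) \<le> M / 2 * (C * (N + N))\<^sup>2" if y: "y \<in> Dom T" "y' \<in> Dom T" for y y'
  proof -
    have "C * norm (y - y') \<le> C * (N + N)"
      using norm_triangle_ineq4[of y y'] N[OF y(1)] N[OF y(2)] C(1) by (intro mult_left_mono) auto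
    then have "p (y - y') \<le> C * (N + N)"
      using C(2) order_trans by blast
    then have "M / 2 * (p (y - y'))\<^sup>2 \<le> M / 2 * (C * (N + N))\<^sup>2"
      using M_pos p_nonneg by (intro mult_left_mono power_mono) auto
    then show ?thesis
      using D_le[of y y'] y Dom_subset by (auto simp: subset_iff min_le_iff_disj)
  qed
  then have "?d \<le> ereal (M / 2 * (C * (N + N))\<^sup>2)"
    unfolding breg_diameter_def by (intro SUP_least) (auto simp: breg simp del: ereal_min)
  \<comment> \<open>A supremum over an empty set would be \<open>-\<infinity>\<close>; a zero of
    \<open>T\<close> rules this out.\<close>
  moreover obtain zs where "zs \<in> Dom T"
    using zeros_ne by (auto simp: zeros_def Dom_def)
  note upper[OF this this]
  ultimately obtain d where "?d = ereal d"
    by (cases ?d) auto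
  show ?thesis
    by (rule that[OF \<open>?d = ereal d\<close>]) (use upper[unfolded \<open>?d = ereal d\<close> ereal_less_eq(3)] in blast)
qed

text \<open>The infimum in \<open>dw0\<close> is not assumed attained. The bound for each zero is
  solved for \<open>D (z 0) zs\<close>, which gives a lower bound uniform in \<open>zs\<close> that
  passes to the infimum; the next three bounds follow the same pattern.\<close>

lemma dual_residual_bound:
  assumes k: "1 \<le> k"
  shows "dual_seminorm p (ergodic lam r k)
    \<le> ereal (2 * sqrt 2 * M * sqrt (real_of_ereal (dw0 w T (z 0)) + eta 0) / (sqrt m * Lam lam k))"
proof -
  obtain d where d: "dw0 w T (z 0) = ereal d" "0 \<le> d"
    "\<And>c. (\<And>zs. zs \<in> zeros T \<Longrightarrow> c \<le> D (z 0) zs) \<Longrightarrow> c \<le> d"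
    using dw0_eq_ereal by blast
  let ?c = "2 * sqrt 2 * M / (sqrt m * Lam lam k)"
  have c: "0 < ?c"
    using M_pos m_pos Lam_pos[OF k] by simp
  have "ergodic lam r k \<bullet> v \<le> ?c * sqrt (d + eta 0)" if v: "p v \<le> 1" for v
  \<comment> \<open>Solving for \<open>D (z 0) zs\<close> squares an inequality, which needs a
    nonnegative left side.\<close>
  proof (cases "0 \<le> ergodic lam r k \<bullet> v")
    case True
    let ?q = "ergodic lam r k \<bullet> v / ?c"
    have "?q\<^sup>2 - eta 0 \<le> d"
    proof (rule d(3))
      fix zs assume zs: "zs \<in> zeros T"
      have "ergodic lam r k \<bullet> v \<le> ?c * sqrt (D (z 0) zs + eta 0)"
        using dual_residual_le[OF k zs] v by (simp add: dual_seminorm_le_iff)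
      then have "?q \<le> sqrt (D (z 0) zs + eta 0)"
        using c by (simp only: pos_divide_le_eq mult.commute)
      then have "?q\<^sup>2 \<le> (sqrt (D (z 0) zs + eta 0))\<^sup>2"
        using True c by (intro power_mono divide_nonneg_pos)
      also have "\<dots> = D (z 0) zs + eta 0"
        using D_nonneg[OF z_Z zeros_Z[OF zs]] eta_nonneg by simp
      finally show "?q\<^sup>2 - eta 0 \<le> D (z 0) zs"
        by simp
    qed
    then have "?q \<le> sqrt (d + eta 0)"
      by (intro real_le_rsqrt) simp
    then show ?thesis
      using c by (simp only: pos_divide_le_eq mult.commute)
  next
    case False
    moreover have "0 \<le> ?c * sqrt (d + eta 0)"
      using c d(2) eta_nonneg[of 0] by (intro mult_nonneg_nonneg) auto
    ultimately show ?thesis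
      by linarith
  qed
  then show ?thesis
    by (simp add: dual_seminorm_le_iff d(1))
qed

lemma ergodic_eps_bound:
  assumes k: "1 \<le> k" and mM: "m \<le> M"
  shows "ereal (ergodic_eps lam eps r zt k)
    \<le> ereal (3 * M / m) * ((3 * (dw0 w T (z 0) + ereal (eta 0)) + ereal \<sigma> * rho w z zt k) / ereal (Lam lam k))"
proof -
  obtain d where d: "dw0 w T (z 0) = ereal d"
    "\<And>c. (\<And>zs. zs \<in> zeros T \<Longrightarrow> c \<le> D (z 0) zs) \<Longrightarrow> c \<le> d"
    using dw0_eq_ereal by blast
  obtain R where R: "rho w z zt k = ereal R" "\<And>i. i \<in> {1..k} \<Longrightarrow> D (z (i - 1)) (zt i) \<le> R"
    using rho_eq_ereal[OF k] by blast
  let ?e = "ergodic_eps lam eps r zt k"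
  define b where "b = 3 * M / m / Lam lam k"
  have b: "0 < b"
    using M_pos m_pos Lam_pos[OF k] by (simp add: b_def)
  define q where "q = ?e / b - \<sigma> * R"
  have "q / 3 - eta 0 \<le> d"
  proof (rule d(2))
    fix zs assume "zs \<in> zeros T"
    then have "?e \<le> b * (3 * (D (z 0) zs + eta 0) + \<sigma> * R)"
      using ergodic_eps_le[OF k mM _ R(2)] by (simp add: b_def)
    then have "?e / b \<le> 3 * (D (z 0) zs + eta 0) + \<sigma> * R"
      using b by (simp only: pos_divide_le_eq mult.commute)
    then have "q \<le> 3 * (D (z 0) zs + eta 0)"
      by (simp add: q_def)
    then show "q / 3 - eta 0 \<le> D (z 0) zs"
      by simp
  qed
  then have "q \<le> 3 * (d + eta 0)"
    by simp
  then have "?e / b \<le> 3 * (d + eta 0) + \<sigma> * R"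
    by (simp add: q_def)
  then have "?e \<le> b * (3 * (d + eta 0) + \<sigma> * R)"
    using b by (simp only: pos_divide_le_eq mult.commute)
  \<comment> \<open>The literal must appear as \<open>ereal 3\<close> for the arithmetic rules on
    finite values to collapse the right side.\<close>
  moreover have "(3::ereal) = ereal 3"
    by simp
  ultimately show ?thesis
    using Lam_pos[OF k] by (simp only: d(1) R(1) plus_ereal.simps times_ereal.simps) (simp add: b_def)
qed

lemma rho_le_of_contraction:
  assumes "\<sigma> < 1" "1 \<le> k"
  shows "rho w z zt k \<le> (dw0 w T (z 0) + ereal (eta 0)) / ereal (1 - \<sigma>)"
proof -
  obtain d where d: "dw0 w T (z 0) = ereal d"
    "\<And>c. (\<And>zs. zs \<in> zeros T \<Longrightarrow> c \<le> D (z 0) zs) \<Longrightarrow> c \<le> d"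
    using dw0_eq_ereal by blast
  obtain R where R: "rho w z zt k = ereal R"
    "\<And>c. (\<And>i. i \<in> {1..k} \<Longrightarrow> D (z (i - 1)) (zt i) \<le> c) \<Longrightarrow> R \<le> c"
    using rho_eq_ereal[OF assms(2)] by blast
  have "R * (1 - \<sigma>) - eta 0 \<le> d"
  proof (rule d(2))
    fix zs assume zs: "zs \<in> zeros T"
    have "R \<le> (D (z 0) zs + eta 0) / (1 - \<sigma>)"
      using step_le_of_contraction[OF assms(1) _ zs] by (intro R(2)) simp
    then show "R * (1 - \<sigma>) - eta 0 \<le> D (z 0) zs"
      using assms(1) by (simp add: pos_le_divide_eq)
  qed
  then show ?thesis
    using assms(1) by (simp add: d(1) R(1) pos_le_divide_eq)
qed

lemma rho_le_of_bounded_Dom: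
  assumes bdd: "bounded (Dom T)" and k: "1 \<le> k"
  shows "rho w z zt k
    \<le> ereal (2 * M / m) * (dw0 w T (z 0) + ereal (eta 0) + breg_diameter w (Dom T))"
proof -
  obtain d where d: "dw0 w T (z 0) = ereal d"
    "\<And>c. (\<And>zs. zs \<in> zeros T \<Longrightarrow> c \<le> D (z 0) zs) \<Longrightarrow> c \<le> d"
    using dw0_eq_ereal by blast
  obtain R where R: "rho w z zt k = ereal R"
    "\<And>c. (\<And>i. i \<in> {1..k} \<Longrightarrow> D (z (i - 1)) (zt i) \<le> c) \<Longrightarrow> R \<le> c"
    using rho_eq_ereal[OF k] by blast
  obtain e where e: "breg_diameter w (Dom T) = ereal e"
    "\<And>y y'. y \<in> Dom T \<Longrightarrow> y' \<in> Dom T \<Longrightarrow> min (D y y') (D y' y) \<le> e"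
    using breg_diameter_eq_ereal[OF bdd] by blast
  define b where "b = 2 * M / m"
  have b: "0 < b"
    using M_pos m_pos by (simp add: b_def)
  have "R / b - e - eta 0 \<le> d"
  proof (rule d(2))
    fix zs assume zs: "zs \<in> zeros T"
    have "R \<le> b * (D (z 0) zs + eta 0 + e)"
      unfolding b_def using step_le_of_bounded_Dom[OF bdd _ zs e(2)] by (intro R(2)) simp
    then have "R / b \<le> D (z 0) zs + eta 0 + e"
      using b by (simp only: pos_divide_le_eq mult.commute)
    then show "R / b - e - eta 0 \<le> D (z 0) zs"
      by simp
  qed
  then have "R / b \<le> d + eta 0 + e"
    by simp
  then have "R \<le> b * (d + eta 0 + e)"
    using b by (simp only: pos_divide_le_eq mult.commute)
  then show ?thesis
    by (simp add: d(1) R(1) e(1) b_def)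
qed

text \<open>Since \<open>rho\<close> is nonnegative, an upper bound also bounds its absolute
  value.\<close>

lemma rho_bounded:
  assumes "\<And>k. 1 \<le> k \<Longrightarrow> rho w z zt k \<le> ereal B"
  shows "\<exists>B::real. \<forall>k\<ge>1. \<bar>rho w z zt k\<bar> \<le> ereal B"
proof (intro exI allI impI)
  fix k :: nat assume k: "1 \<le> k"
  then show "\<bar>rho w z zt k\<bar> \<le> ereal B"
    using rho_eq_ereal[OF k] assms[OF k] by (metis abs_ereal_ge0 ereal_less_eq(5))
qed

end

text \<open>\<open>real_of_ereal\<close> is harmless because \<open>dw0\<close> is finite here. The
  premise on the third bound excludes \<open>M < m\<close> with \<open>p\<close> vanishing on all
  differences in \<open>Z\<close>: for a singleton \<open>Z\<close> and \<open>M\<close> small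
  against \<open>m\<close>, \<open>eta 0 > 0\<close> can be spent on \<open>eps 1\<close> and
  violate it.\<close>

theorem theorem3p4:
  fixes w :: "'a::euclidean_space \<Rightarrow> ereal"
    and Z :: "'a set" and p :: "'a \<Rightarrow> real" and m M \<sigma> :: real
    and T :: "'a \<Rightarrow> 'a set"
    and zt z r :: "nat \<Rightarrow> 'a" and eps lam eta :: "nat \<Rightarrow> real"
  assumes "closed Z" and "convex Z" and "Z \<subseteq> interior (edom w)"
    and "seminorm p"
    and "distance_generating w" and "regular_wrt m M w Z p"
    and "maximal_monotone T" and "Dom T \<subseteq> Z" and "zeros T \<noteq> {}"
    and "ne_hpe w Z T \<sigma> zt z r eps lam eta"
  shows
    "(\<forall>k\<ge>1.
        ergodic lam r k \<in> enlargement T (ergodic_eps lam eps r zt k) (ergodic lam zt k) \<and>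
        dual_seminorm p (ergodic lam r k)
          \<le> ereal (2 * sqrt 2 * M * sqrt (real_of_ereal (dw0 w T (z 0)) + eta 0)
                     / (sqrt m * Lam lam k)) \<and>
        ((\<exists>x\<in>Z. \<exists>y\<in>Z. p (x - y) \<noteq> 0) \<or> m \<le> M \<longrightarrow>
          ereal (ergodic_eps lam eps r zt k)
            \<le> ereal (3 * M / m) *
                ((3 * (dw0 w T (z 0) + ereal (eta 0)) + ereal \<sigma> * rho w z zt k)
                   / ereal (Lam lam k)))) \<and>
     (\<sigma> < 1 \<longrightarrow>
        (\<exists>B::real. \<forall>k\<ge>1. \<bar>rho w z zt k\<bar> \<le> ereal B) \<and>
        (\<forall>k\<ge>1. rho w z zt k \<le> (dw0 w T (z 0) + ereal (eta 0)) / ereal (1 - \<sigma>))) \<and>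
     (bounded (Dom T) \<longrightarrow>
        (\<exists>B::real. \<forall>k\<ge>1. \<bar>rho w z zt k\<bar> \<le> ereal B) \<and>
        (\<forall>k\<ge>1. rho w z zt k
           \<le> ereal (2 * M / m) * (dw0 w T (z 0) + ereal (eta 0) + breg_diameter w (Dom T))))"
proof -
  interpret ne_hpe_run w Z p m M T \<sigma> zt z r eps lam eta
    using assms by unfold_locales
  obtain d where d: "dw0 w T (z 0) = ereal d"
    using dw0_eq_ereal by blast
  have contr: "rho w z zt k \<le> (dw0 w T (z 0) + ereal (eta 0)) / ereal (1 - \<sigma>)" if "\<sigma> < 1" "1 \<le> k" for k
    by (rule rho_le_of_contraction[OF that])
  have bdd: "rho w z zt k \<le> ereal (2 * M / m) * (dw0 w T (z 0) + ereal (eta 0) + breg_diameter w (Dom T))"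
    if "bounded (Dom T)" "1 \<le> k" for k
    by (rule rho_le_of_bounded_Dom[OF that])
  have "\<exists>B::real. \<forall>k\<ge>1. \<bar>rho w z zt k\<bar> \<le> ereal B" if "\<sigma> < 1"
    using contr[OF that] that by (intro rho_bounded[of "(d + eta 0) / (1 - \<sigma>)"]) (simp add: d)
  moreover have "\<exists>B::real. \<forall>k\<ge>1. \<bar>rho w z zt k\<bar> \<le> ereal B" if "bounded (Dom T)"
  proof -
    obtain e where "breg_diameter w (Dom T) = ereal e"
      using breg_diameter_eq_ereal[OF \<open>bounded (Dom T)\<close>] by blast
    then show ?thesis
      using bdd[OF \<open>bounded (Dom T)\<close>] by (intro rho_bounded[of "2 * M / m * (d + eta 0 + e)"]) (simp add: d)
  qed
  moreover have "ergodic lam r k \<in> enlargement T (ergodic_eps lam eps r zt k) (ergodic lam zt k)"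
    if "1 \<le> k" for k
    using Lam_pos[OF that] lam_pos r_enlargement
    by (intro ergodic_mem_enlargement) (auto intro: less_imp_le)
  moreover have "m \<le> M" if "(\<exists>x\<in>Z. \<exists>y\<in>Z. p (x - y) \<noteq> 0) \<or> m \<le> M"
    using that m_le_M by blast
  ultimately show ?thesis
    using contr bdd dual_residual_bound ergodic_eps_bound by blast
qed

end
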